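(* The double bilinear Hilbert transform $B_d$, defined for functions $f,g$ on $\mathbb{R}^2$ by $$B_d(f,g)(x,y)=\int_{\mathbb{R}^2}f(x-t_1,y-t_2)\,g(x+t_1,y+t_2)\,\frac{dt_1}{t_1}\frac{dt_2}{t_2},\qquad (x,y)\in\mathbb{R}^2,$$ does not satisfy any $L^p$ estimates.
   Context: $B_d$ is the bi-parameter analogue of the bilinear Hilbert transform $B(f_1,f_2)(x)=\int_{\mathbb{R}}f_1(x-t)f_2(x+t)\frac{dt}{t}$ on the real line. Up to a nonzero multiplicative constant, $B_d$ is the bilinear multiplier operator $$\int_{\mathbb{R}^4}\mathrm{sgn}(\xi_1-\xi_2)\,\mathrm{sgn}(\eta_1-\eta_2)\,\widehat f(\xi_1,\eta_1)\,\widehat g(\xi_2,\eta_2)\,e^{2\pi i (x,y)\cdot((\xi_1,\eta_1)+(\xi_2,\eta_2))}\,d\xi\,d\eta .$$ An $L^p$ estimate here means a bound of the form $\|B_d(f,g)\|_r\le C\|f\|_p\|g\|_q$ (boundedness $L^p\times L^q\to L^r$ on $\mathbb{R}^2$), with exponents related as usual by $1/r=1/p+1/q$. *)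

theory Defs
  imports "HOL-Probability.Essential_Supremum"
begin

definition partial_x :: "(real \<times> real \<Rightarrow> complex) \<Rightarrow> real \<times> real \<Rightarrow> complex" where
  "partial_x f = (\<lambda>(x, y). vector_derivative (\<lambda>s. f (s, y)) (at x))"

definition partial_y :: "(real \<times> real \<Rightarrow> complex) \<Rightarrow> real \<times> real \<Rightarrow> complex" where
  "partial_y f = (\<lambda>(x, y). vector_derivative (\<lambda>s. f (x, s)) (at y))"

(* Differentiability of every \<partial>\<^sub>x^m \<partial>\<^sub>y^n f amounts to smoothness: all these functions are then
   continuous, and the order of differentiation is immaterial. *)
definition schwartz :: "(real \<times> real \<Rightarrow> complex) \<Rightarrow> bool" where
  "schwartz f \<longleftrightarrow>
     (\<forall>m n z. ((partial_x ^^ m) ((partial_y ^^ n) f)) differentiable (at z)) \<and>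
     (\<forall>a b m n :: nat. bounded (range (\<lambda>z :: real \<times> real.
        (fst z ^ a * snd z ^ b) *\<^sub>R (partial_x ^^ m) ((partial_y ^^ n) f) z)))"

(* The L^p (quasi-)norm on the plane for 0 < p \<le> \<infinity>. The case distinction on the integral I is
   only there because powr is not available on ennreal: the value is I^(1/p). *)
definition Lp_norm :: "ennreal \<Rightarrow> (real \<times> real \<Rightarrow> complex) \<Rightarrow> ennreal" where
  "Lp_norm p f =
     (if p = \<infinity> then esssup lborel (\<lambda>z. ennreal (norm (f z)))
      else let I = \<integral>\<^sup>+ z. ennreal (norm (f z) powr enn2real p) \<partial>lborel
           in if I = \<infinity> then \<infinity> else ennreal (enn2real I powr (1 / enn2real p)))"

definition double_BHT_trunc ::
    "real \<times> real \<Rightarrow> (real \<times> real \<Rightarrow> complex) \<Rightarrow> (real \<times> real \<Rightarrow> complex) \<Rightarrow> real \<times> real \<Rightarrow> complex" where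
  "double_BHT_trunc = (\<lambda>(\<epsilon>\<^sub>1, \<epsilon>\<^sub>2) f g (x, y).
     LINT (t\<^sub>1, t\<^sub>2) : {(t\<^sub>1, t\<^sub>2). \<epsilon>\<^sub>1 < \<bar>t\<^sub>1\<bar> \<and> \<epsilon>\<^sub>2 < \<bar>t\<^sub>2\<bar>} | lborel.
       f (x - t\<^sub>1, y - t\<^sub>2) * g (x + t\<^sub>1, y + t\<^sub>2) / complex_of_real (t\<^sub>1 * t\<^sub>2))"

(* The singular integral in the sense of principal values, the two truncation parameters tending
   to 0 independently. For Schwartz functions f and g the truncated integrals converge absolutely
   and the limit exists at every point: pairing (\<plusminus>t\<^sub>1, \<plusminus>t\<^sub>2) turns the integrand into a second
   difference divided by t\<^sub>1 t\<^sub>2, which is absolutely integrable on t\<^sub>1, t\<^sub>2 > 0. *)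
definition double_BHT ::
    "(real \<times> real \<Rightarrow> complex) \<Rightarrow> (real \<times> real \<Rightarrow> complex) \<Rightarrow> real \<times> real \<Rightarrow> complex" where
  "double_BHT f g z =
     Lim (at_right 0 \<times>\<^sub>F at_right 0) (\<lambda>\<epsilon>. double_BHT_trunc \<epsilon> f g z)"

(* Boundedness L^p \<times> L^q \<rightarrow> L^r, as an a priori estimate on Schwartz functions. *)
definition satisfies_Lp_estimate ::
    "((real \<times> real \<Rightarrow> complex) \<Rightarrow> (real \<times> real \<Rightarrow> complex) \<Rightarrow> real \<times> real \<Rightarrow> complex) \<Rightarrow>
     ennreal \<Rightarrow> ennreal \<Rightarrow> ennreal \<Rightarrow> bool" where
  "satisfies_Lp_estimate B p q r \<longleftrightarrow>
     (\<exists>C :: real. \<forall>f g. schwartz f \<longrightarrow> schwartz g \<longrightarrow>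
        Lp_norm r (B f g) \<le> ennreal C * Lp_norm p f * Lp_norm q g)"

end

(* Test the estimate on the Gaussian chirps f = g = exp (i c x y - (x^2 + y^2) / 4). Since
   (x - t)(y - u) + (x + t)(y + u) = 2 x y + 2 t u and the Gaussians factor in the same way,
   B_d(f, f) = K(c) f^2, where
     K(c) = p.v. \<integral> exp (2 i c t u) exp (- (t^2 + u^2) / 2) dt du / (t u) = 2 \<pi> i arsinh (2 c).
   The modulus of f does not depend on c, so neither do the norms of f, whereas K(c) tends to
   infinity with c. *)

theory Submission
  imports Defs "HOL-Probability.Characteristic_Functions"
begin

section \<open>Gaussian integrals on the plane\<close>

text \<open>Why K(c) grows: the kernel 1 / (t u) is odd in each variable, so only the sine part of
  exp (2 i c t u) survives. The quotient sin (2 c t u) / (t u) has size about 2 c where |t u| is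
  below about 1 / c. This is a neighbourhood of both axes, and its portion under the Gaussian has
  area of order log c / c, so the total mass is of order log c. In one variable, sin (2 c t) / t is
  large only on an interval of length about 1 / c, and its integral stays bounded. The obstacle is
  that 1 / (t u) is not absolutely integrable near the axes, so Fubini does not apply to the kernel
  itself. Averaging over the reflection of t alone replaces the oscillating kernel by a bounded
  function. The principal value then becomes an ordinary integral, a truncation changes it by at
  most a constant times \<open>\<epsilon>\<^sub>1 + \<epsilon>\<^sub>2\<close>, and its exact value
  is accessible by Fubini. On the other side of the estimate, the output is never normed exactly: a
  lower bound on one fixed square, uniform in the exponent, is enough.\<close>

lemma borel_measurable_fst_snd [measurable (raw)]:
  fixes f :: "'a \<Rightarrow> 'b::second_countable_topology \<times> 'c::second_countable_topology"
  assumes "f \<in> borel_measurable M"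
  shows "(\<lambda>x. fst (f x)) \<in> borel_measurable M" and "(\<lambda>x. snd (f x)) \<in> borel_measurable M"
  using measurable_compose[OF assms, of fst borel] measurable_compose[OF assms, of snd borel]
  by (simp_all flip: borel_prod)

text \<open>The factors range over arbitrary Euclidean spaces because one use has a line and a plane
  as factors, namely the Fubini argument in \<open>integral_osc_gauss_pair\<close>.\<close>

lemma lborel_pair_mult:
  fixes f :: "'a::euclidean_space \<Rightarrow> real" and g :: "'b::euclidean_space \<Rightarrow> real"
  assumes "integrable lborel f" and "integrable lborel g"
  shows integrable_lborel_pair_mult: "integrable lborel (\<lambda>z. f (fst z) * g (snd z))"
    and integral_lborel_pair_mult:
      "(\<integral>z. f (fst z) * g (snd z) \<partial>lborel) = integral\<^sup>L lborel f * integral\<^sup>L lborel g"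
proof -
  have [measurable]: "f \<in> borel_measurable borel" "g \<in> borel_measurable borel"
    using borel_measurable_integrable[OF assms(1)] borel_measurable_integrable[OF assms(2)] by simp_all
  have int: "integrable (lborel \<Otimes>\<^sub>M lborel) (\<lambda>z. f (fst z) * g (snd z))"
  proof (rule lborel_pair.Fubini_integrable)
    show "(\<lambda>z. f (fst z) * g (snd z)) \<in> borel_measurable (lborel \<Otimes>\<^sub>M lborel)"
      by measurable
    show "integrable lborel (\<lambda>x. LINT y|lborel. norm (f (fst (x, y)) * g (snd (x, y))))"
      using assms by (simp add: abs_mult)
    show "AE x in lborel. integrable lborel (\<lambda>y. f (fst (x, y)) * g (snd (x, y)))"
      using assms by simp
  qed
  then show "integrable lborel (\<lambda>z. f (fst z) * g (snd z))"
    by (simp add: lborel_prod)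
  have "(\<integral>z. f (fst z) * g (snd z) \<partial>(lborel \<Otimes>\<^sub>M lborel)) = (\<integral>x. \<integral>y. f x * g y \<partial>lborel \<partial>lborel)"
    using lborel_pair.integral_fst'[OF int] by simp
  then show "(\<integral>z. f (fst z) * g (snd z) \<partial>lborel) = integral\<^sup>L lborel f * integral\<^sup>L lborel g"
    by (simp add: lborel_prod)
qed

text \<open>This is the weight in t left over when two chirp envelopes are multiplied at
  \<open>x - t\<close> and \<open>x + t\<close>. Up to the factor \<open>sqrt (2 * pi)\<close> it is
  the standard normal density, whose moments and characteristic function supply the integrals
  below.\<close>

definition gauss :: "real \<Rightarrow> real" where
  "gauss x = exp (- x\<^sup>2 / 2)"

lemma gauss_pos: "0 < gauss x"
  by (simp add: gauss_def)

lemma gauss_le_1: "gauss x \<le> 1"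
  by (simp add: gauss_def)

lemma gauss_minus [simp]: "gauss (- x) = gauss x"
  by (simp add: gauss_def)

lemma borel_measurable_gauss [measurable]: "gauss \<in> borel_measurable borel"
  unfolding gauss_def by measurable

lemma gauss_eq_normal_density: "gauss x = sqrt (2 * pi) * std_normal_density x"
  by (simp add: gauss_def std_normal_density_def)

lemma integrable_gauss: "integrable lborel gauss"
  using integrable_std_normal_moment[of 0] by (simp add: gauss_eq_normal_density[abs_def])

lemma integral_gauss: "integral\<^sup>L lborel gauss = sqrt (2 * pi)"
  using integral_std_normal_moment_even[of 0] by (simp add: gauss_eq_normal_density[abs_def])

lemma integral_gauss_scale:
  assumes "0 < k"
  shows "(\<integral>x. gauss (k * x) \<partial>lborel) = sqrt (2 * pi) / k"
  using lborel_integral_real_affine[of k gauss 0] assms integral_gauss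
  by (simp add: field_simps)

text \<open>The real part of the characteristic function of the standard normal law: the Gaussian is
  its own Fourier transform up to a constant.\<close>

lemma integral_cos_gauss: "(\<integral>x. cos (t * x) * gauss x \<partial>lborel) = sqrt (2 * pi) * gauss t"
proof -
  have int: "integrable lborel (\<lambda>x. std_normal_density x *\<^sub>R iexp (t * x))"
  proof (rule Bochner_Integration.integrable_bound)
    show "integrable lborel std_normal_density"
      using integrable_std_normal_moment[of 0] by simp
  qed (simp_all add: normal_density_nonneg)
  have "(\<integral>x. std_normal_density x *\<^sub>R iexp (t * x) \<partial>lborel) = complex_of_real (gauss t)"
    using fun_cong[OF char_std_normal_distribution, of t]
    by (simp add: char_def integral_density normal_density_nonneg gauss_def)
  then have "Re (\<integral>x. std_normal_density x *\<^sub>R iexp (t * x) \<partial>lborel) = gauss t"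
    by simp
  then have "(\<integral>x. std_normal_density x * cos (t * x) \<partial>lborel) = gauss t"
    using int by (simp add: integral_Re[symmetric] Re_exp)
  moreover have "(\<integral>x. cos (t * x) * gauss x \<partial>lborel)
      = (\<integral>x. sqrt (2 * pi) * (std_normal_density x * cos (t * x)) \<partial>lborel)"
    by (intro Bochner_Integration.integral_cong) (simp_all add: gauss_eq_normal_density)
  ultimately show ?thesis
    by simp
qed

lemma gauss_mult_gauss: "gauss x * gauss (s * x) = gauss (sqrt (1 + s\<^sup>2) * x)"
  by (simp add: gauss_def exp_add[symmetric] power_mult_distrib add_divide_distrib algebra_simps)

lemma integrable_gauss_pair: "integrable lborel (\<lambda>z. gauss (fst z) * gauss (snd z))"
  by (intro integrable_lborel_pair_mult integrable_gauss)

text \<open>For fixed x the cosine has frequency \<open>s * x\<close> in y, so the inner integral is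
  a multiple of \<open>gauss (s * x)\<close>. Together with \<open>gauss x\<close> this is again a
  Gaussian, rescaled by \<open>sqrt (1 + s\<^sup>2)\<close>.\<close>

lemma integral_cos_gauss_pair:
  "(\<integral>z. cos (s * (fst z * snd z)) * (gauss (fst z) * gauss (snd z)) \<partial>lborel)
     = 2 * pi / sqrt (1 + s\<^sup>2)"
proof -
  have "integrable (lborel \<Otimes>\<^sub>M lborel)
      (\<lambda>z. cos (s * (fst z * snd z)) * (gauss (fst z) * gauss (snd z)))"
  proof (rule Bochner_Integration.integrable_bound)
    show "integrable (lborel \<Otimes>\<^sub>M lborel) (\<lambda>z. gauss (fst z) * gauss (snd z))"
      using integrable_gauss_pair by (simp add: lborel_prod)
  qed (auto intro!: AE_I2 mult_left_le_one_le simp: abs_mult gauss_pos less_imp_le)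
  from lborel_pair.integral_fst'[OF this]
  have "(\<integral>z. cos (s * (fst z * snd z)) * (gauss (fst z) * gauss (snd z)) \<partial>lborel)
      = (\<integral>x. \<integral>y. gauss x * (cos ((s * x) * y) * gauss y) \<partial>lborel \<partial>lborel)"
    by (simp add: lborel_prod mult_ac)
  also have "\<dots> = (\<integral>x. gauss x * (sqrt (2 * pi) * gauss (s * x)) \<partial>lborel)"
    by (simp add: integral_cos_gauss)
  also have "\<dots> = (\<integral>x. sqrt (2 * pi) * gauss (sqrt (1 + s\<^sup>2) * x) \<partial>lborel)"
    by (intro Bochner_Integration.integral_cong) (simp_all flip: gauss_mult_gauss)
  also have "\<dots> = 2 * pi / sqrt (1 + s\<^sup>2)"
    by (simp add: integral_gauss_scale add_pos_nonneg)
  finally show ?thesis .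
qed

text \<open>Writing \<open>sin (2 c u) / u\<close> as an integral of cosines (with the value \<open>2 c\<close> at \<open>u = 0\<close>, where
  division would give \<open>0\<close>) lets Fubini reduce the kernel to Gaussian Fourier transforms.\<close>

definition osc :: "real \<Rightarrow> real \<Rightarrow> real" where
  "osc c u = (\<integral>s. indicator {0..2 * c} s * cos (s * u) \<partial>lborel)"

lemma integrable_indicator_Icc: "integrable lborel (indicator {a..b :: real} :: real \<Rightarrow> real)"
  by (rule integrable_real_indicator) (simp_all add: emeasure_lborel_Icc_eq)

lemma integrable_osc:
  fixes c u :: real
  shows "integrable lborel (\<lambda>s. indicator {0..2 * c} s * cos (s * u))"
proof (rule Bochner_Integration.integrable_bound)
  show "integrable lborel (indicator {0..2 * c} :: real \<Rightarrow> real)"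
    by (rule integrable_indicator_Icc)
qed (auto simp: indicator_def)

lemma borel_measurable_osc [measurable]: "osc c \<in> borel_measurable borel"
  unfolding osc_def[abs_def] by measurable

lemma abs_osc_le:
  assumes "0 \<le> c"
  shows "\<bar>osc c u\<bar> \<le> 2 * c"
proof -
  have "\<bar>osc c u\<bar> \<le> (\<integral>s. \<bar>indicator {0..2 * c} s * cos (s * u)\<bar> \<partial>lborel)"
    unfolding osc_def by (rule integral_abs_bound)
  also have "\<dots> \<le> (\<integral>s. indicator {0..2 * c} s \<partial>lborel)"
    by (intro integral_mono integrable_abs integrable_osc integrable_indicator_Icc) (auto simp: indicator_def)
  also have "\<dots> = 2 * c"
    using assms by simp
  finally show ?thesis .
qed

lemma osc_eq_sin:
  assumes "0 \<le> c" and "u \<noteq> 0"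
  shows "osc c u = sin (2 * c * u) / u"
proof -
  have "(\<integral>s. cos (s * u) * indicator {0..2 * c} s \<partial>lborel) = sin (2 * c * u) / u - sin (0 * u) / u"
    using assms by (intro integral_FTC_Icc_real) (auto intro!: derivative_eq_intros)
  then show ?thesis
    by (simp add: osc_def mult.commute)
qed

text \<open>After the exchange of integrals, the integrand in s is 2 pi / sqrt (1 + s^2), the
  derivative of 2 pi arsinh s. Its decay like 1 / s is the source of the logarithmic growth in
  c.\<close>

lemma integral_osc_gauss_pair:
  assumes "0 \<le> c"
  shows "(\<integral>z. osc c (fst z * snd z) * (gauss (fst z) * gauss (snd z)) \<partial>lborel) = 2 * pi * arsinh (2 * c)"
proof -
  let ?w = "\<lambda>z. gauss (fst z) * gauss (snd z)"
  let ?F = "\<lambda>s z. indicator {0..2 * c} s * (cos (s * (fst z * snd z)) * ?w z)"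
  have "integrable (lborel \<Otimes>\<^sub>M lborel) (case_prod ?F)"
  proof (rule Bochner_Integration.integrable_bound)
    show "integrable (lborel \<Otimes>\<^sub>M lborel)
        (\<lambda>x :: real \<times> real \<times> real. indicator {0..2 * c} (fst x) * ?w (snd x) :: real)"
      unfolding lborel_prod by (rule integrable_lborel_pair_mult) (simp_all add: integrable_gauss_pair integrable_indicator_Icc)
    show "case_prod ?F \<in> borel_measurable (lborel \<Otimes>\<^sub>M lborel)"
      by measurable
  qed (auto intro!: AE_I2 mult_left_le_one_le simp: indicator_def abs_mult gauss_pos less_imp_le)
  from lborel_pair.Fubini_integral[OF this]
  have "(\<integral>z. osc c (fst z * snd z) * ?w z \<partial>lborel)
      = (\<integral>s. \<integral>z. ?F s z \<partial>lborel \<partial>lborel)"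
    by (simp add: osc_def mult.assoc[symmetric] del: integral_mult_right_zero)
  also have "\<dots> = (\<integral>s. indicator {0..2 * c} s * (\<integral>z. cos (s * (fst z * snd z)) * ?w z \<partial>lborel) \<partial>lborel)"
    by (simp only: integral_mult_right_zero)
  also have "\<dots> = (\<integral>s. 2 * pi * (1 / sqrt (s\<^sup>2 + 1)) * indicator {0..2 * c} s \<partial>lborel)"
    by (simp only: integral_cos_gauss_pair) (simp add: add.commute mult.commute)
  also have "\<dots> = 2 * pi * arsinh (2 * c) - 2 * pi * arsinh 0"
    using assms
    by (intro integral_FTC_Icc_real) (auto intro!: derivative_eq_intros continuous_intros simp: add_nonneg_eq_0_iff)
  finally show ?thesis by simp
qed

section \<open>The double Hilbert transform of a Gaussian chirp\<close>

text \<open>Only one coordinate is reflected: \<open>z \<mapsto> - z\<close> preserves the product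
  of the coordinates and hence the kernel, so it would produce no cancellation. The invariance comes
  from viewing planar Lebesgue measure as a product and applying \<open>uminus\<close> to its first
  factor.\<close>

lemma integral_lborel_reflect_fst:
  fixes f :: "real \<times> real \<Rightarrow> 'a::{banach, second_countable_topology}"
  assumes [measurable]: "f \<in> borel_measurable borel"
  shows "(\<integral>z. f (- fst z, snd z) \<partial>lborel) = integral\<^sup>L lborel f"
    and "integrable lborel (\<lambda>z. f (- fst z, snd z)) \<longleftrightarrow> integrable lborel f"
proof -
  have "distr lborel borel uminus \<Otimes>\<^sub>M distr lborel borel (\<lambda>x. x)
      = distr (lborel \<Otimes>\<^sub>M lborel) (borel \<Otimes>\<^sub>M borel) (\<lambda>(x :: real, y :: real). (- x, y))"
    by (rule pair_measure_distr) (simp_all add: distr_id2 lborel.sigma_finite_measure_axioms)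
  then have eq: "distr lborel borel (\<lambda>z :: real \<times> real. (- fst z, snd z)) = lborel"
    by (simp add: lborel_distr_uminus lborel_prod borel_prod distr_id2 case_prod_unfold)
  have "integral\<^sup>L (distr lborel borel (\<lambda>z. (- fst z, snd z))) f = (\<integral>z. f (- fst z, snd z) \<partial>lborel)"
    by (rule integral_distr) measurable
  then show "(\<integral>z. f (- fst z, snd z) \<partial>lborel) = integral\<^sup>L lborel f"
    by (simp add: eq)
  have "integrable (distr lborel borel (\<lambda>z. (- fst z, snd z))) f \<longleftrightarrow>
      integrable lborel (\<lambda>z. f (- fst z, snd z))"
    by (rule integrable_distr_eq) measurable
  then show "integrable lborel (\<lambda>z. f (- fst z, snd z)) \<longleftrightarrow> integrable lborel f"
    by (simp add: eq)
qed

definition chirp :: "real \<Rightarrow> real \<times> real \<Rightarrow> complex" where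
  "chirp c z = exp (of_real (- ((fst z)\<^sup>2 + (snd z)\<^sup>2) / 4) + \<i> * of_real (c * (fst z * snd z)))"

lemma norm_chirp: "norm (chirp c z) = exp (- ((fst z)\<^sup>2 + (snd z)\<^sup>2) / 4)"
  by (simp add: chirp_def)

lemma chirp_mult_chirp:
  "chirp c (x - t, y - u) * chirp c (x + t, y + u)
     = (chirp c (x, y))\<^sup>2 * (iexp (2 * c * (t * u)) * of_real (gauss t * gauss u))"
proof -
  have "chirp c (x - t, y - u) * chirp c (x + t, y + u) =
    exp (2 * (of_real (- (x\<^sup>2 + y\<^sup>2) / 4) + \<i> * of_real (c * (x * y)))
      + (\<i> * of_real (2 * c * (t * u)) + of_real (- t\<^sup>2 / 2 + - u\<^sup>2 / 2)))"
    unfolding chirp_def exp_add[symmetric]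
    by (intro arg_cong[where f = exp] complex_eqI) (simp_all add: power2_eq_square field_simps)
  also have "\<dots> = (chirp c (x, y))\<^sup>2 * (iexp (2 * c * (t * u)) * of_real (gauss t * gauss u))"
    unfolding exp_add exp_double chirp_def gauss_def
    by (simp add: exp_of_real[symmetric] exp_add[symmetric] del: exp_of_real)
  finally show ?thesis .
qed

definition trunc_set :: "real \<times> real \<Rightarrow> (real \<times> real) set" where
  "trunc_set = (\<lambda>(\<epsilon>\<^sub>1, \<epsilon>\<^sub>2). {(t\<^sub>1, t\<^sub>2). \<epsilon>\<^sub>1 < \<bar>t\<^sub>1\<bar> \<and> \<epsilon>\<^sub>2 < \<bar>t\<^sub>2\<bar>})"

lemma mem_trunc_set: "z \<in> trunc_set \<epsilon> \<longleftrightarrow> fst \<epsilon> < \<bar>fst z\<bar> \<and> snd \<epsilon> < \<bar>snd z\<bar>"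
  by (simp add: trunc_set_def case_prod_unfold)

lemma trunc_set_borel [measurable]: "trunc_set \<epsilon> \<in> sets borel"
proof -
  have "trunc_set \<epsilon> = {z \<in> space borel. fst \<epsilon> < \<bar>fst z\<bar> \<and> snd \<epsilon> < \<bar>snd z\<bar>}"
    by (auto simp: mem_trunc_set)
  also have "\<dots> \<in> sets borel"
    by measurable
  finally show ?thesis .
qed

lemma iexp_diff_iexp: "iexp x - iexp (- x) = 2 * \<i> * of_real (sin x)"
  by (auto simp: complex_eq_iff Re_exp Im_exp)

lemma integral_trunc_iexp_gauss:
  assumes "0 < \<epsilon>\<^sub>1" and "0 < \<epsilon>\<^sub>2" and "0 \<le> c"
  shows "(\<integral>z. indicator (trunc_set (\<epsilon>\<^sub>1, \<epsilon>\<^sub>2)) z *\<^sub>R (iexp (2 * c * (fst z * snd z)) *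
            of_real (gauss (fst z) * gauss (snd z)) / of_real (fst z * snd z)) \<partial>lborel)
     = \<i> * of_real (\<integral>z. indicator (trunc_set (\<epsilon>\<^sub>1, \<epsilon>\<^sub>2)) z *
            (osc c (fst z * snd z) * (gauss (fst z) * gauss (snd z))) \<partial>lborel)"
    (is "integral\<^sup>L lborel ?F = \<i> * of_real (integral\<^sup>L lborel ?G)")
proof -
  have [measurable]: "?F \<in> borel_measurable borel"
    by measurable
  have int: "integrable lborel ?F"
  proof (rule Bochner_Integration.integrable_bound)
    \<comment> \<open>On the truncated region |1 / (t u)| is at most
      \<open>1 / (\<epsilon>\<^sub>1 * \<epsilon>\<^sub>2)\<close>. This gives absolute convergence
      for fixed parameters but degenerates in the limit, which is why the limit is taken only after
      passing to \<open>osc\<close>.\<close>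
    show "integrable lborel (\<lambda>z. 1 / (\<epsilon>\<^sub>1 * \<epsilon>\<^sub>2) * (gauss (fst z) * gauss (snd z)))"
      using integrable_gauss_pair by simp
    have "gauss t * gauss u / (\<bar>t\<bar> * \<bar>u\<bar>) \<le> gauss t * gauss u / (\<epsilon>\<^sub>1 * \<epsilon>\<^sub>2)"
      if "\<epsilon>\<^sub>1 < \<bar>t\<bar>" "\<epsilon>\<^sub>2 < \<bar>u\<bar>" for t u
      using that assms gauss_pos[of t] gauss_pos[of u]
      by (intro divide_left_mono mult_mono mult_pos_pos) auto
    then show "AE z in lborel. norm (?F z) \<le> norm (1 / (\<epsilon>\<^sub>1 * \<epsilon>\<^sub>2) * (gauss (fst z) * gauss (snd z)))"
      using assms gauss_pos
      by (intro AE_I2) (auto simp: mem_trunc_set indicator_def norm_mult norm_divide abs_mult less_imp_le)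
  qed measurable
  \<comment> \<open>The reflection \<open>t \<mapsto> - t\<close> cancels the even part of the kernel and leaves the bounded function \<open>osc\<close>.\<close>
  have sym: "?F z + ?F (- fst z, snd z) = 2 * \<i> * of_real (?G z)" for z
  proof (cases "z \<in> trunc_set (\<epsilon>\<^sub>1, \<epsilon>\<^sub>2)")
    case True
    let ?p = "fst z * snd z" and ?w = "gauss (fst z) * gauss (snd z)"
    have ne: "?p \<noteq> 0" and refl: "(- fst z, snd z) \<in> trunc_set (\<epsilon>\<^sub>1, \<epsilon>\<^sub>2)"
      using True assms by (auto simp: mem_trunc_set)
    have "?F z + ?F (- fst z, snd z)
        = (iexp (2 * c * ?p) - iexp (- (2 * c * ?p))) * of_real ?w / of_real ?p"
      using True refl by (simp add: diff_divide_distrib left_diff_distrib)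
    also have "\<dots> = 2 * \<i> * of_real (sin (2 * c * ?p) / ?p * ?w)"
      unfolding iexp_diff_iexp by simp
    also have "\<dots> = 2 * \<i> * of_real (?G z)"
      using True by (simp add: osc_eq_sin[OF assms(3) ne])
    finally show ?thesis .
  next
    case False
    then show ?thesis
      by (auto simp: mem_trunc_set indicator_def)
  qed
  have "2 * integral\<^sup>L lborel ?F = integral\<^sup>L lborel ?F + (\<integral>z. ?F (- fst z, snd z) \<partial>lborel)"
    by (subst integral_lborel_reflect_fst(1)[of ?F]) simp_all
  also have "\<dots> = (\<integral>z. ?F z + ?F (- fst z, snd z) \<partial>lborel)"
    by (intro Bochner_Integration.integral_add[symmetric] int iffD2[OF integral_lborel_reflect_fst(2)[of ?F]])
      measurable
  also have "\<dots> = 2 * \<i> * of_real (integral\<^sup>L lborel ?G)"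
    unfolding sym by (simp del: of_real_mult)
  finally show ?thesis
    by simp
qed

lemma double_BHT_trunc_chirp:
  assumes "0 < fst \<epsilon>" and "0 < snd \<epsilon>" and "0 \<le> c"
  shows "double_BHT_trunc \<epsilon> (chirp c) (chirp c) z = (chirp c z)\<^sup>2 * (\<i> * of_real
    (\<integral>z. indicator (trunc_set \<epsilon>) z * (osc c (fst z * snd z) * (gauss (fst z) * gauss (snd z))) \<partial>lborel))"
proof -
  obtain \<epsilon>\<^sub>1 \<epsilon>\<^sub>2 x y where eq: "\<epsilon> = (\<epsilon>\<^sub>1, \<epsilon>\<^sub>2)" "z = (x, y)"
    by (metis prod.exhaust)
  have "double_BHT_trunc \<epsilon> (chirp c) (chirp c) z
    = (\<integral>w. (chirp c z)\<^sup>2 * (indicator (trunc_set (\<epsilon>\<^sub>1, \<epsilon>\<^sub>2)) w *\<^sub>R (iexp (2 * c * (fst w * snd w)) *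
            of_real (gauss (fst w) * gauss (snd w)) / of_real (fst w * snd w))) \<partial>lborel)"
    unfolding double_BHT_trunc_def eq set_lebesgue_integral_def prod.case trunc_set_def
      case_prod_unfold chirp_mult_chirp
    by (intro Bochner_Integration.integral_cong) (simp_all add: scaleR_conv_of_real)
  also have "\<dots> = (chirp c z)\<^sup>2 * (\<integral>w. indicator (trunc_set (\<epsilon>\<^sub>1, \<epsilon>\<^sub>2)) w *\<^sub>R (iexp (2 * c * (fst w * snd w)) *
            of_real (gauss (fst w) * gauss (snd w)) / of_real (fst w * snd w)) \<partial>lborel)"
    by (rule integral_mult_right_zero)
  finally show ?thesis
    using integral_trunc_iexp_gauss[of \<epsilon>\<^sub>1 \<epsilon>\<^sub>2 c] assms by (simp add: eq)
qed

text \<open>The region removed by the truncation is the union of two strips around the axes. There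
  the integrand is at most 2 c times the Gaussians, and the Gaussian in the narrow variable is at
  most 1, so a strip of half-width \<open>\<epsilon>\<close> contributes at most
  \<open>2 * c * (2 * \<epsilon>) * sqrt (2 * pi)\<close>. The bound treats the two parameters
  separately, as their independent limits require.\<close>

lemma trunc_integral_error:
  assumes "0 < \<epsilon>\<^sub>1" and "0 < \<epsilon>\<^sub>2" and "0 \<le> c"
  shows "\<bar>(\<integral>z. indicator (trunc_set (\<epsilon>\<^sub>1, \<epsilon>\<^sub>2)) z *
            (osc c (fst z * snd z) * (gauss (fst z) * gauss (snd z))) \<partial>lborel)
          - (\<integral>z. osc c (fst z * snd z) * (gauss (fst z) * gauss (snd z)) \<partial>lborel)\<bar>
       \<le> 4 * c * sqrt (2 * pi) * (\<epsilon>\<^sub>1 + \<epsilon>\<^sub>2)"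
    (is "\<bar>integral\<^sup>L lborel (\<lambda>z. ?I z * ?G z) - _\<bar> \<le> _")
proof -
  let ?H = "\<lambda>z. 2 * c * (indicator {- \<epsilon>\<^sub>1..\<epsilon>\<^sub>1} (fst z) * gauss (snd z))
      + 2 * c * (gauss (fst z) * indicator {- \<epsilon>\<^sub>2..\<epsilon>\<^sub>2} (snd z))"
  have int_Icc: "(\<integral>x. indicator {- \<epsilon>..\<epsilon>} x \<partial>lborel) = (2 * \<epsilon> :: real)" if "0 \<le> \<epsilon>" for \<epsilon> :: real
    using that by simp
  have bound: "\<bar>?G z\<bar> \<le> 2 * c * (gauss (fst z) * gauss (snd z))" for z
    using abs_osc_le[OF assms(3), of "fst z * snd z"] gauss_pos
    by (simp add: abs_mult mult_right_mono less_imp_le)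
  have G: "integrable lborel ?G"
  proof (rule Bochner_Integration.integrable_bound)
    show "integrable lborel (\<lambda>z. 2 * c * (gauss (fst z) * gauss (snd z)))"
      using integrable_gauss_pair by simp
    show "AE z in lborel. norm (?G z) \<le> norm (2 * c * (gauss (fst z) * gauss (snd z)))"
      using order_trans[OF bound abs_ge_self] by (intro AE_I2) (simp only: real_norm_def)
  qed measurable
  have IG: "integrable lborel (\<lambda>z. ?I z * ?G z)"
    by (rule Bochner_Integration.integrable_bound[OF G]) (auto simp: indicator_def)
  have H1: "integrable lborel (\<lambda>z. indicator {- \<epsilon>\<^sub>1..\<epsilon>\<^sub>1} (fst z) * gauss (snd z))"
    and H2: "integrable lborel (\<lambda>z. gauss (fst z) * indicator {- \<epsilon>\<^sub>2..\<epsilon>\<^sub>2} (snd z))"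
    by (intro integrable_lborel_pair_mult integrable_gauss integrable_indicator_Icc)+
  have H: "(\<integral>z. indicator {- \<epsilon>\<^sub>1..\<epsilon>\<^sub>1} (fst z) * gauss (snd z) \<partial>lborel) = 2 * \<epsilon>\<^sub>1 * sqrt (2 * pi)"
    "(\<integral>z. gauss (fst z) * indicator {- \<epsilon>\<^sub>2..\<epsilon>\<^sub>2} (snd z) \<partial>lborel) = sqrt (2 * pi) * (2 * \<epsilon>\<^sub>2)"
    using assms
    by (simp_all only: integral_lborel_pair_mult integrable_gauss integrable_indicator_Icc integral_gauss int_Icc less_imp_le)
  have "\<bar>?I z * ?G z - ?G z\<bar> \<le> ?H z" for z
  proof (cases "z \<in> trunc_set (\<epsilon>\<^sub>1, \<epsilon>\<^sub>2)")
    case True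
    then show ?thesis
      using assms gauss_pos by (simp add: less_imp_le)
  next
    case False
    then consider "fst z \<in> {- \<epsilon>\<^sub>1..\<epsilon>\<^sub>1}" | "snd z \<in> {- \<epsilon>\<^sub>2..\<epsilon>\<^sub>2}"
      by (fastforce simp: mem_trunc_set)
    then have "gauss (fst z) * gauss (snd z)
        \<le> indicator {- \<epsilon>\<^sub>1..\<epsilon>\<^sub>1} (fst z) * gauss (snd z) + gauss (fst z) * indicator {- \<epsilon>\<^sub>2..\<epsilon>\<^sub>2} (snd z)"
    proof cases
      case 1
      have "gauss (fst z) * gauss (snd z) \<le> 1 * gauss (snd z)"
        using gauss_le_1 gauss_pos by (intro mult_right_mono) (auto simp: less_imp_le)
      then show ?thesis
        using 1 gauss_pos by (auto simp: less_imp_le intro: add_increasing2)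
    next
      case 2
      have "gauss (fst z) * gauss (snd z) \<le> gauss (fst z) * 1"
        using gauss_le_1 gauss_pos by (intro mult_left_mono) (auto simp: less_imp_le)
      then show ?thesis
        using 2 gauss_pos by (auto simp: less_imp_le intro: add_increasing)
    qed
    from mult_left_mono[OF this, of "2 * c"] show ?thesis
      using False bound[of z] assms by (simp add: algebra_simps)
  qed
  then have "(\<integral>z. \<bar>?I z * ?G z - ?G z\<bar> \<partial>lborel) \<le> (\<integral>z. ?H z \<partial>lborel)"
    using G IG H1 H2 by (intro integral_mono) auto
  also have "(\<integral>z. ?H z \<partial>lborel) = 4 * c * sqrt (2 * pi) * (\<epsilon>\<^sub>1 + \<epsilon>\<^sub>2)"
    by (simp only: Bochner_Integration.integral_add integrable_mult_right H1 H2 integral_mult_right_zero H)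
      (simp add: algebra_simps)
  finally have "(\<integral>z. \<bar>?I z * ?G z - ?G z\<bar> \<partial>lborel) \<le> 4 * c * sqrt (2 * pi) * (\<epsilon>\<^sub>1 + \<epsilon>\<^sub>2)" .
  moreover have "\<bar>(\<integral>z. ?I z * ?G z - ?G z \<partial>lborel)\<bar> \<le> (\<integral>z. \<bar>?I z * ?G z - ?G z\<bar> \<partial>lborel)"
    by (rule integral_abs_bound)
  ultimately show ?thesis
    using G IG by simp
qed

lemma double_BHT_chirp:
  assumes "0 \<le> c"
  shows "double_BHT (chirp c) (chirp c) z = (chirp c z)\<^sup>2 * (\<i> * of_real (2 * pi * arsinh (2 * c)))"
proof -
  let ?P = "at_right 0 \<times>\<^sub>F at_right 0 :: (real \<times> real) filter"
  let ?G = "\<lambda>z. osc c (fst z * snd z) * (gauss (fst z) * gauss (snd z))"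
  let ?T = "\<lambda>\<epsilon>. \<integral>z. indicator (trunc_set \<epsilon>) z * ?G z \<partial>lborel"
  have pos: "\<forall>\<^sub>F \<epsilon> in ?P. 0 < fst \<epsilon> \<and> 0 < snd \<epsilon>"
    by (intro eventually_prodI eventually_at_right_less)
  have "(?T \<longlongrightarrow> integral\<^sup>L lborel ?G) ?P"
  proof (rule Lim_transform[OF tendsto_const])
    have lim: "((\<lambda>\<epsilon>. 4 * c * sqrt (2 * pi) * (fst \<epsilon> + snd \<epsilon>)) \<longlongrightarrow> 4 * c * sqrt (2 * pi) * (0 + 0)) ?P"
      by (intro tendsto_intros filterlim_compose[OF _ filterlim_fst] filterlim_compose[OF _ filterlim_snd]
          tendsto_ident_at)
    show "((\<lambda>\<epsilon>. ?T \<epsilon> - integral\<^sup>L lborel ?G) \<longlongrightarrow> 0) ?P"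
    proof (rule Lim_null_comparison)
      show "\<forall>\<^sub>F \<epsilon> in ?P. norm (?T \<epsilon> - integral\<^sup>L lborel ?G) \<le> 4 * c * sqrt (2 * pi) * (fst \<epsilon> + snd \<epsilon>)"
        using pos
      proof eventually_elim
        case (elim \<epsilon>)
        then show ?case
          using trunc_integral_error[of "fst \<epsilon>" "snd \<epsilon>" c] assms
          by simp
      qed
      show "((\<lambda>\<epsilon>. 4 * c * sqrt (2 * pi) * (fst \<epsilon> + snd \<epsilon>)) \<longlongrightarrow> 0) ?P"
        using lim by simp
    qed
  qed
  then have "((\<lambda>\<epsilon>. (chirp c z)\<^sup>2 * (\<i> * of_real (?T \<epsilon>))) \<longlongrightarrow>
      (chirp c z)\<^sup>2 * (\<i> * of_real (2 * pi * arsinh (2 * c)))) ?P"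
    unfolding integral_osc_gauss_pair[OF assms] by (intro tendsto_intros)
  then have "((\<lambda>\<epsilon>. double_BHT_trunc \<epsilon> (chirp c) (chirp c) z) \<longlongrightarrow>
      (chirp c z)\<^sup>2 * (\<i> * of_real (2 * pi * arsinh (2 * c)))) ?P"
    by (rule Lim_transform_eventually)
      (use pos in eventually_elim, simp only: double_BHT_trunc_chirp assms)
  then show ?thesis
    \<comment> \<open>\<open>Lim\<close> is a definite description: its value is known only because
      the limit has been shown to exist and is unique, the product of two nontrivial filters being
      nontrivial.\<close>
    unfolding double_BHT_def by (intro tendsto_Lim) (simp_all add: prod_filter_eq_bot)
qed

section \<open>Gaussian chirps are Schwartz functions\<close>

text \<open>Complex polynomials in the two coordinates, given by closure rules rather than
  coefficients, so that differentiability, derivatives and growth all follow by rule induction.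
  Every iterated partial derivative of a chirp is such a polynomial times the chirp.\<close>

inductive_set plane_poly :: "(real \<times> real \<Rightarrow> complex) set" where
  const: "(\<lambda>_. a) \<in> plane_poly"
| fst: "(\<lambda>z. of_real (fst z)) \<in> plane_poly"
| snd: "(\<lambda>z. of_real (snd z)) \<in> plane_poly"
| add: "P \<in> plane_poly \<Longrightarrow> Q \<in> plane_poly \<Longrightarrow> (\<lambda>z. P z + Q z) \<in> plane_poly"
| mult: "P \<in> plane_poly \<Longrightarrow> Q \<in> plane_poly \<Longrightarrow> (\<lambda>z. P z * Q z) \<in> plane_poly"

lemma plane_poly_power: "P \<in> plane_poly \<Longrightarrow> (\<lambda>z. P z ^ n) \<in> plane_poly"
  by (induction n) (auto intro: plane_poly.intros)

lemma plane_poly_differentiable: "P \<in> plane_poly \<Longrightarrow> P differentiable at z"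
proof (induction rule: plane_poly.induct)
  case fst
  show ?case
    by (rule differentiableI[of _ "\<lambda>h. of_real (fst h)"]) (auto intro!: derivative_eq_intros)
next
  case snd
  show ?case
    by (rule differentiableI[of _ "\<lambda>h. of_real (snd h)"]) (auto intro!: derivative_eq_intros)
qed simp_all

lemma plane_poly_vector_derivative:
  assumes "P \<in> plane_poly"
  shows "\<exists>Q\<in>plane_poly. \<forall>x y. ((\<lambda>s. P (s, y)) has_vector_derivative Q (x, y)) (at x)"
    and "\<exists>Q\<in>plane_poly. \<forall>x y. ((\<lambda>s. P (x, s)) has_vector_derivative Q (x, y)) (at y)"
  using assms
proof (induction rule: plane_poly.induct)
  case (const a)
  { case 1 show ?case by (rule bexI[OF _ plane_poly.const[of 0]]) simp }
  { case 2 show ?case by (rule bexI[OF _ plane_poly.const[of 0]]) simp }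
next
  case fst
  { case 1 show ?case
      by (rule bexI[OF _ plane_poly.const[of 1]]) (auto intro!: derivative_eq_intros) }
  { case 2 show ?case by (rule bexI[OF _ plane_poly.const[of 0]]) simp }
next
  case snd
  { case 1 show ?case by (rule bexI[OF _ plane_poly.const[of 0]]) simp }
  { case 2 show ?case
      by (rule bexI[OF _ plane_poly.const[of 1]]) (auto intro!: derivative_eq_intros) }
next
  case (add P Q)
  { case 1
    from add obtain P' Q' where "P' \<in> plane_poly" "Q' \<in> plane_poly"
      "\<And>x y. ((\<lambda>s. P (s, y)) has_vector_derivative P' (x, y)) (at x)"
      "\<And>x y. ((\<lambda>s. Q (s, y)) has_vector_derivative Q' (x, y)) (at x)"
      by blast
    then show ?case
      by (intro bexI[of _ "\<lambda>z. P' z + Q' z"]) (auto intro: plane_poly.add has_vector_derivative_add) }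
  { case 2
    from add obtain P' Q' where "P' \<in> plane_poly" "Q' \<in> plane_poly"
      "\<And>x y. ((\<lambda>s. P (x, s)) has_vector_derivative P' (x, y)) (at y)"
      "\<And>x y. ((\<lambda>s. Q (x, s)) has_vector_derivative Q' (x, y)) (at y)"
      by blast
    then show ?case
      by (intro bexI[of _ "\<lambda>z. P' z + Q' z"]) (auto intro: plane_poly.add has_vector_derivative_add) }
next
  case (mult P Q)
  { case 1
    from mult obtain P' Q' where "P' \<in> plane_poly" "Q' \<in> plane_poly"
      "\<And>x y. ((\<lambda>s. P (s, y)) has_vector_derivative P' (x, y)) (at x)"
      "\<And>x y. ((\<lambda>s. Q (s, y)) has_vector_derivative Q' (x, y)) (at x)"
      by blast
    with mult.hyps show ?case
      by (intro bexI[of _ "\<lambda>z. P z * Q' z + P' z * Q z"])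
        (auto intro!: plane_poly.add plane_poly.mult has_vector_derivative_mult) }
  { case 2
    from mult obtain P' Q' where "P' \<in> plane_poly" "Q' \<in> plane_poly"
      "\<And>x y. ((\<lambda>s. P (x, s)) has_vector_derivative P' (x, y)) (at y)"
      "\<And>x y. ((\<lambda>s. Q (x, s)) has_vector_derivative Q' (x, y)) (at y)"
      by blast
    with mult.hyps show ?case
      by (intro bexI[of _ "\<lambda>z. P z * Q' z + P' z * Q z"])
        (auto intro!: plane_poly.add plane_poly.mult has_vector_derivative_mult) }
qed

lemma abs_le_exp_square:
  fixes x :: real
  assumes "0 < e"
  shows "\<bar>x\<bar> \<le> (1 + 1 / e) * exp (e * x\<^sup>2)"
proof -
  have "\<bar>x\<bar> \<le> 1 + x\<^sup>2"
    by sos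
  \<comment> \<open>The product expands to 1 + x^2 plus the nonnegative terms 1 / e and e
    x^2.\<close>
  also have "\<dots> \<le> (1 + 1 / e) * (1 + e * x\<^sup>2)"
    using assms by (simp add: field_simps)
  also have "\<dots> \<le> (1 + 1 / e) * exp (e * x\<^sup>2)"
    using assms exp_ge_add_one_self[of "e * x\<^sup>2"] by (intro mult_left_mono) (auto simp: add.commute)
  finally show ?thesis .
qed

text \<open>The rate \<open>e\<close> is arbitrary so that the induction can give each factor of a
  product the rate \<open>e / 2\<close>.\<close>

lemma plane_poly_growth:
  assumes "P \<in> plane_poly" and "0 < e"
  shows "\<exists>C. \<forall>z. norm (P z) \<le> C * exp (e * ((fst z)\<^sup>2 + (snd z)\<^sup>2))"
  using assms
proof (induction arbitrary: e rule: plane_poly.induct)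
  case (const a)
  have "norm a \<le> norm a * exp (e * ((fst z)\<^sup>2 + (snd z)\<^sup>2))" for z :: "real \<times> real"
    using mult_left_mono[OF one_le_exp_iff[THEN iffD2] norm_ge_zero, of "e * ((fst z)\<^sup>2 + (snd z)\<^sup>2)" a] const
    by simp
  then show ?case by blast
next
  case fst
  have "norm (complex_of_real (fst z)) \<le> (1 + 1 / e) * exp (e * ((fst z)\<^sup>2 + (snd z)\<^sup>2))" for z :: "real \<times> real"
    using fst abs_le_exp_square[OF fst, of "fst z"]
    by (auto intro!: order_trans[OF abs_le_exp_square[OF fst, of "fst z"]] mult_left_mono)
  then show ?case by blast
next
  case snd
  have "norm (complex_of_real (snd z)) \<le> (1 + 1 / e) * exp (e * ((fst z)\<^sup>2 + (snd z)\<^sup>2))" for z :: "real \<times> real"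
    using snd by (auto intro!: order_trans[OF abs_le_exp_square[OF snd, of "snd z"]] mult_left_mono)
  then show ?case by blast
next
  case (add P Q)
  from add.IH[OF add.prems] obtain C D where
    "\<And>z. norm (P z) \<le> C * exp (e * ((fst z)\<^sup>2 + (snd z)\<^sup>2))"
    "\<And>z. norm (Q z) \<le> D * exp (e * ((fst z)\<^sup>2 + (snd z)\<^sup>2))"
    by blast
  then have "norm (P z + Q z) \<le> (C + D) * exp (e * ((fst z)\<^sup>2 + (snd z)\<^sup>2))" for z
    by (simp add: distrib_right norm_triangle_mono)
  then show ?case by blast
next
  case (mult P Q)
  let ?E = "\<lambda>z. exp (e / 2 * ((fst z)\<^sup>2 + (snd z)\<^sup>2))"
  from mult.IH[of "e / 2"] mult.prems obtain C D where
    CD: "\<And>z. norm (P z) \<le> C * ?E z" "\<And>z. norm (Q z) \<le> D * ?E z"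
    by (metis half_gt_zero)
  have "norm (P z * Q z) \<le> (C * D) * exp (e * ((fst z)\<^sup>2 + (snd z)\<^sup>2))" for z
  proof -
    have "norm (P z * Q z) \<le> (C * ?E z) * (D * ?E z)"
      unfolding norm_mult using order_trans[OF norm_ge_zero CD(1)] by (intro mult_mono CD) auto
    also have "\<dots> = (C * D) * exp (e * ((fst z)\<^sup>2 + (snd z)\<^sup>2))"
      by (simp add: exp_add[symmetric] field_simps)
    finally show ?thesis .
  qed
  then show ?case by blast
qed

lemma chirp_eq_exp_plane_poly:
  obtains P where "P \<in> plane_poly" and "chirp c = (\<lambda>z. exp (P z))"
proof
  show "(\<lambda>z. of_real (- 1 / 4) * (of_real (fst z) ^ 2 + of_real (snd z) ^ 2)
        + \<i> * of_real c * (of_real (fst z) * of_real (snd z))) \<in> plane_poly"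
    by (intro plane_poly.intros plane_poly_power)
  show "chirp c = (\<lambda>z. exp (of_real (- 1 / 4) * (of_real (fst z) ^ 2 + of_real (snd z) ^ 2)
        + \<i> * of_real c * (of_real (fst z) * of_real (snd z))))"
    unfolding chirp_def fun_eq_iff by (intro allI arg_cong[where f = exp]) (simp add: field_simps)
qed

text \<open>With the chirp written as exp R for a polynomial R, the product rule gives (P exp R)' =
  (P R' + P') exp R, and the bracket is again a polynomial.\<close>

lemma
  assumes "P \<in> plane_poly"
  shows partial_x_plane_poly_chirp:
      "\<exists>Q\<in>plane_poly. partial_x (\<lambda>z. P z * chirp c z) = (\<lambda>z. Q z * chirp c z)"
    and partial_y_plane_poly_chirp:
      "\<exists>Q\<in>plane_poly. partial_y (\<lambda>z. P z * chirp c z) = (\<lambda>z. Q z * chirp c z)"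
proof -
  obtain R where R: "R \<in> plane_poly" and chirp: "chirp c = (\<lambda>z. exp (R z))"
    by (rule chirp_eq_exp_plane_poly)
  have exp_deriv: "((\<lambda>s. exp (r s)) has_vector_derivative r' * exp (r t)) (at t)"
    if "(r has_vector_derivative r') (at t)" for r :: "real \<Rightarrow> complex" and r' t
    using field_vector_diff_chain_at[OF that DERIV_exp] by (simp add: o_def)
  obtain P' R' where D: "P' \<in> plane_poly" "R' \<in> plane_poly"
    "\<And>x y. ((\<lambda>s. P (s, y)) has_vector_derivative P' (x, y)) (at x)"
    "\<And>x y. ((\<lambda>s. R (s, y)) has_vector_derivative R' (x, y)) (at x)"
    using plane_poly_vector_derivative(1) assms R by metis
  have "((\<lambda>s. P (s, y) * chirp c (s, y)) has_vector_derivative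
      (P (x, y) * R' (x, y) + P' (x, y)) * chirp c (x, y)) (at x)" for x y
    unfolding chirp using has_vector_derivative_mult[OF D(3) exp_deriv[OF D(4)], of y y x]
    by (simp add: algebra_simps)
  then have "partial_x (\<lambda>z. P z * chirp c z) = (\<lambda>z. (P z * R' z + P' z) * chirp c z)"
    by (auto simp: partial_x_def fun_eq_iff intro!: vector_derivative_at)
  with D assms show "\<exists>Q\<in>plane_poly. partial_x (\<lambda>z. P z * chirp c z) = (\<lambda>z. Q z * chirp c z)"
    by (intro bexI[of _ "\<lambda>z. P z * R' z + P' z"]) (auto intro: plane_poly.intros)
  obtain P' R' where D: "P' \<in> plane_poly" "R' \<in> plane_poly"
    "\<And>x y. ((\<lambda>s. P (x, s)) has_vector_derivative P' (x, y)) (at y)"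
    "\<And>x y. ((\<lambda>s. R (x, s)) has_vector_derivative R' (x, y)) (at y)"
    using plane_poly_vector_derivative(2) assms R by metis
  have "((\<lambda>s. P (x, s) * chirp c (x, s)) has_vector_derivative
      (P (x, y) * R' (x, y) + P' (x, y)) * chirp c (x, y)) (at y)" for x y
    unfolding chirp using has_vector_derivative_mult[OF D(3) exp_deriv[OF D(4)], of x x y]
    by (simp add: algebra_simps)
  then have "partial_y (\<lambda>z. P z * chirp c z) = (\<lambda>z. (P z * R' z + P' z) * chirp c z)"
    by (auto simp: partial_y_def fun_eq_iff intro!: vector_derivative_at)
  with D assms show "\<exists>Q\<in>plane_poly. partial_y (\<lambda>z. P z * chirp c z) = (\<lambda>z. Q z * chirp c z)"
    by (intro bexI[of _ "\<lambda>z. P z * R' z + P' z"]) (auto intro: plane_poly.intros)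
qed

lemma iterated_partials_chirp:
  "\<exists>P\<in>plane_poly. (partial_x ^^ m) ((partial_y ^^ n) (chirp c)) = (\<lambda>z. P z * chirp c z)"
proof (induction m)
  case 0
  show ?case
  proof (induction n)
    case 0
    show ?case
      by (rule bexI[OF _ plane_poly.const[of 1]]) simp
  next
    case (Suc n)
    then show ?case
      using partial_y_plane_poly_chirp by auto
  qed
next
  case (Suc m)
  then show ?case
    using partial_x_plane_poly_chirp by auto
qed

lemma schwartz_chirp: "schwartz (chirp c)"
  unfolding schwartz_def
proof (intro conjI allI)
  fix m n :: nat and z :: "real \<times> real"
  obtain P where P: "P \<in> plane_poly"
    "(partial_x ^^ m) ((partial_y ^^ n) (chirp c)) = (\<lambda>z. P z * chirp c z)"
    using iterated_partials_chirp by blast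
  obtain R where R: "R \<in> plane_poly" "chirp c = (\<lambda>z. exp (R z))"
    by (rule chirp_eq_exp_plane_poly)
  have "(exp \<circ> R) differentiable at z"
    using plane_poly_differentiable[OF R(1)]
    by (intro differentiable_chain_at field_differentiable_imp_differentiable)
      (auto simp: field_differentiable_def intro: DERIV_exp)
  then show "((partial_x ^^ m) ((partial_y ^^ n) (chirp c))) differentiable at z"
    unfolding P(2) using plane_poly_differentiable[OF P(1)] by (simp add: R(2) o_def)
next
  fix a b m n :: nat
  obtain P where P: "P \<in> plane_poly"
    "(partial_x ^^ m) ((partial_y ^^ n) (chirp c)) = (\<lambda>z. P z * chirp c z)"
    using iterated_partials_chirp by blast
  have "(\<lambda>z. of_real (fst z) ^ a * of_real (snd z) ^ b * P z) \<in> plane_poly"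
    using P by (intro plane_poly.intros plane_poly_power)
  \<comment> \<open>The rate 1 / 4 is the decay rate of the chirp, so the two exponentials cancel
    exactly and leave the constant \<open>C\<close>.\<close>
  from plane_poly_growth[OF this, of "1 / 4"] obtain C where
    C: "\<And>z. norm (of_real (fst z) ^ a * of_real (snd z) ^ b * P z) \<le> C * exp (1 / 4 * ((fst z)\<^sup>2 + (snd z)\<^sup>2))"
    by (metis zero_less_divide_1_iff zero_less_numeral)
  have "norm ((fst z ^ a * snd z ^ b) *\<^sub>R (P z * chirp c z)) \<le> C" for z
  proof -
    have "norm ((fst z ^ a * snd z ^ b) *\<^sub>R (P z * chirp c z))
        = norm (of_real (fst z) ^ a * of_real (snd z) ^ b * P z) * norm (chirp c z)"
      by (simp add: norm_mult norm_power abs_mult power_abs)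
    also have "\<dots> \<le> (C * exp (1 / 4 * ((fst z)\<^sup>2 + (snd z)\<^sup>2))) * norm (chirp c z)"
      by (intro mult_right_mono C) simp
    also have "\<dots> = C"
      by (simp add: norm_chirp exp_minus field_simps flip: exp_add)
    finally show ?thesis .
  qed
  then show "bounded (range (\<lambda>z. (fst z ^ a * snd z ^ b) *\<^sub>R (partial_x ^^ m) ((partial_y ^^ n) (chirp c)) z))"
    unfolding P(2) by (intro boundedI[of _ C]) blast
qed

section \<open>Norm bounds\<close>

lemma Lp_norm_cong_norm:
  assumes "\<And>z. norm (f z) = norm (g z)"
  shows "Lp_norm p f = Lp_norm p g"
  by (simp add: Lp_norm_def assms)

text \<open>The unit square has measure 1, so the pointwise bound passes to the quasi-norm with the
  same constant for every exponent. Only monotonicity of the integral is involved, so exponents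
  below 1, where the triangle inequality fails, need no separate treatment.\<close>

lemma Lp_norm_ge_on_unit_square:
  assumes "0 < p" and [measurable]: "f \<in> borel_measurable borel"
    and M: "0 \<le> M" "\<And>z. z \<in> cbox (0, 0) (1, 1) \<Longrightarrow> M \<le> norm (f z)"
  shows "ennreal M \<le> Lp_norm p f"
proof (cases "p = \<infinity>")
  case True
  show ?thesis
  proof (rule ccontr)
    assume *: "\<not> ennreal M \<le> Lp_norm p f"
    have "AE z in lborel. ennreal (norm (f z)) \<le> Lp_norm p f"
      unfolding Lp_norm_def using True by (simp add: esssup_AE)
    then have "AE z in lborel. z \<notin> cbox (0 :: real, 0 :: real) (1, 1)"
      by (rule eventually_mono) (use * M(2) ennreal_leI order_trans in blast)
    then have "emeasure lborel (cbox (0 :: real, 0 :: real) (1, 1)) = 0"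
      by (subst (asm) AE_iff_measurable[OF _ refl]) simp_all
    then show False
      by (simp add: emeasure_lborel_cbox_eq Basis_prod_def)
  qed
next
  case False
  let ?q = "enn2real p"
  have q: "0 < ?q"
    using \<open>0 < p\<close> False by (simp add: enn2real_positive_iff less_top)
  define I where "I = (\<integral>\<^sup>+ z. ennreal (norm (f z) powr ?q) \<partial>lborel)"
  have "(\<integral>\<^sup>+ z. ennreal (M powr ?q) * indicator (cbox (0 :: real, 0 :: real) (1, 1)) z \<partial>lborel) \<le> I"
    unfolding I_def using M q
    by (intro nn_integral_mono) (auto simp: indicator_def intro!: ennreal_leI powr_mono2)
  then have I: "ennreal (M powr ?q) \<le> I"
    by (simp add: nn_integral_cmult_indicator emeasure_lborel_cbox_eq Basis_prod_def)
  show ?thesis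
  proof (cases "I = \<infinity>")
    case True
    then show ?thesis
      using False by (simp add: Lp_norm_def I_def)
  next
    case fin: False
    have "M powr ?q \<le> enn2real I"
      using I fin by (simp add: ennreal_le_iff2 less_top enn2real_mono[of "ennreal (M powr ?q)", simplified])
    then have "(M powr ?q) powr (1 / ?q) \<le> enn2real I powr (1 / ?q)"
      using q by (intro powr_mono2) auto
    then have "M \<le> enn2real I powr (1 / ?q)"
      using q M by (simp add: powr_powr)
    then show ?thesis
      using False fin by (simp add: Lp_norm_def I_def Let_def ennreal_leI)
  qed
qed

lemma borel_measurable_chirp [measurable]: "chirp c \<in> borel_measurable borel"
  unfolding chirp_def[abs_def] by measurable

lemma Lp_norm_chirp_finite:
  assumes "0 < p"
  shows "Lp_norm p (chirp c) < \<infinity>"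
proof (cases "p = \<infinity>")
  case True
  have "esssup lborel (\<lambda>z. ennreal (norm (chirp c z))) \<le> 1"
    by (intro esssup_I AE_I2) (simp_all add: norm_chirp ennreal_le_1)
  then show ?thesis
    using True by (auto simp: Lp_norm_def intro: le_less_trans)
next
  case False
  \<comment> \<open>The p-th power of the envelope is exp (- p (x^2 + y^2) / 4), a product of two
    Gaussians rescaled by k with k^2 / 2 = p / 4.\<close>
  let ?k = "sqrt (enn2real p / 2)"
  have k: "0 < ?k"
    using \<open>0 < p\<close> False by (simp add: enn2real_positive_iff less_top)
  have "integrable lborel (\<lambda>x. gauss (?k * x))"
    using lborel_integrable_real_affine[OF integrable_gauss, of ?k 0] k by simp
  then have "integrable lborel (\<lambda>z. gauss (?k * fst z) * gauss (?k * snd z))"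
    by (intro integrable_lborel_pair_mult)
  then have "(\<integral>\<^sup>+ z. ennreal (norm (gauss (?k * fst z) * gauss (?k * snd z))) \<partial>lborel) < \<infinity>"
    by (simp add: integrable_iff_bounded)
  moreover have "norm (chirp c z) powr enn2real p = norm (gauss (?k * fst z) * gauss (?k * snd z))" for z
    by (simp add: norm_chirp gauss_def powr_def power_mult_distrib field_simps flip: exp_add)
  ultimately show ?thesis
    using False by (simp add: Lp_norm_def Let_def)
qed

theorem theorem7p1:
  fixes p q r :: ennreal
  assumes "0 < p" and "0 < q" and "1 / r = 1 / p + 1 / q"
  shows "\<not> satisfies_Lp_estimate double_BHT p q r"
proof
  assume "satisfies_Lp_estimate double_BHT p q r"
  then obtain C where C: "Lp_norm r (double_BHT f g) \<le> ennreal C * Lp_norm p f * Lp_norm q g"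
    if "schwartz f" "schwartz g" for f g
    unfolding satisfies_Lp_estimate_def by blast
  \<comment> \<open>In \<open>ennreal\<close> the inverse of 0 is infinite, so \<open>r = 0\<close>
    would force one of 1 / p and 1 / q to be infinite. The case where p, q and r are all infinite
    remains included.\<close>
  have "1 / r < \<infinity>"
    using assms by (simp add: divide_ennreal_def ennreal_inverse_eq_top_iff less_top[symmetric] zero_less_iff_neq_zero)
  then have r: "0 < r"
    by (auto simp: divide_ennreal_def zero_less_iff_neq_zero)
  \<comment> \<open>The right-hand side of the estimate for all chirps at once, since it depends on
    them only through their modulus.\<close>
  define N where "N = ennreal C * Lp_norm p (chirp 0) * Lp_norm q (chirp 0)"
  have "N < \<infinity>"
    using Lp_norm_chirp_finite[of p 0] Lp_norm_chirp_finite[of q 0] assms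
    by (simp add: N_def ennreal_mult_less_top)
  then obtain B where B: "0 \<le> B" "N = ennreal B"
    by (cases N) auto
  \<comment> \<open>The factor \<open>exp (- 1)\<close> is the minimum over the unit square of the
    squared modulus exp (- (x^2 + y^2) / 2) of a chirp, attained at the corner (1, 1).\<close>
  have bound: "2 * pi * arsinh (2 * c) * exp (- 1) \<le> B" if "0 \<le> c" for c
  proof -
    let ?M = "2 * pi * arsinh (2 * c)"
    have M: "0 \<le> ?M"
      using that arsinh_real_neg_iff[of "2 * c"] by (intro mult_nonneg_nonneg) (auto simp flip: not_less)
    have eq: "double_BHT (chirp c) (chirp c) = (\<lambda>z. (chirp c z)\<^sup>2 * (\<i> * of_real ?M))"
      using that by (simp add: fun_eq_iff double_BHT_chirp)
    have "ennreal (?M * exp (- 1)) \<le> Lp_norm r (double_BHT (chirp c) (chirp c))"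
    proof (rule Lp_norm_ge_on_unit_square[OF r])
      fix z :: "real \<times> real"
      assume "z \<in> cbox (0, 0) (1, 1)"
      then have "(fst z)\<^sup>2 + (snd z)\<^sup>2 \<le> 2"
        using power_le_one[of "fst z" 2] power_le_one[of "snd z" 2] by (cases z) (auto simp: cbox_Pair_eq)
      then have "exp (- 1) \<le> norm ((chirp c z)\<^sup>2)"
        by (simp add: norm_power norm_chirp flip: exp_double)
      then have "?M * exp (- 1) \<le> ?M * norm ((chirp c z)\<^sup>2)"
        using M by (rule mult_left_mono)
      then show "?M * exp (- 1) \<le> norm (double_BHT (chirp c) (chirp c) z)"
        unfolding eq norm_mult norm_ii norm_of_real abs_of_nonneg[OF M] by (simp add: mult.commute)
    qed (use M in \<open>simp_all add: eq\<close>)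
    also have "\<dots> \<le> ennreal C * Lp_norm p (chirp c) * Lp_norm q (chirp c)"
      by (intro C schwartz_chirp)
    also have "\<dots> = N"
      unfolding N_def by (simp add: Lp_norm_cong_norm[of "chirp c" "chirp 0"] norm_chirp)
    finally show ?thesis
      using B by (simp add: ennreal_le_iff)
  qed
  \<comment> \<open>Chosen so that \<open>2 * pi * x * exp (- 1)\<close> equals
    \<open>B + 1\<close>. The parameter \<open>c = sinh x / 2\<close> then makes
    \<open>arsinh (2 * c)\<close> equal to \<open>x\<close>, which contradicts
    \<open>bound\<close>.\<close>
  define x where "x = (B + 1) * exp 1 / (2 * pi)"
  have "0 \<le> x"
    using B by (simp add: x_def)
  then have "2 * pi * arsinh (2 * (sinh x / 2)) * exp (- 1) \<le> B"
    by (intro bound) simp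
  then show False
    using mult_pos_pos[OF pi_gt_zero exp_gt_zero[of "1 :: real"]]
    by (simp add: arsinh_sinh_real x_def exp_minus field_simps)
qed

end
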